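(* Let $T>0$, let $a:\mathbb{R}\to\mathbb{H}$ be continuous and $T$-periodic, and consider the quaternion-valued Hill's equation $\ddot u+a(t)u=0$. Let $M(t)$ be the principal fundamental matrix at $t=0$ of the equivalent first-order system. Then: (1) if $|\mathcal{R}(\mathrm{tr}\,M(T))|>2$, the equation is unstable; (2) if $\mathcal{R}(\mathrm{tr}\,M(T))=2$, the equation is stable if and only if $M(T)=I$; (3) if $\mathcal{R}(\mathrm{tr}\,M(T))=-2$, the equation is stable if and only if $M(T)=-I$.
   Context: $\mathbb{H}$ is the real quaternion algebra; $\mathcal{R}(q)=q_0$ is the scalar part of $q=q_0+q_1\mathbf{i}+q_2\mathbf{j}+q_3\mathbf{k}$. With $\boldsymbol{x}=(u,u')^T$, Hill's equation is equivalent to the $T$-periodic system $\dot{\boldsymbol{x}}=A(t)\boldsymbol{x}$ in $\mathbb{H}^2$ with $A(t)=\begin{pmatrix}0&1\\-a(t)&0\end{pmatrix}$. The principal fundamental matrix at $t=0$ is the $\mathbb{H}^{2\times2}$-valued solution of $\dot M=A(t)M$ with $M(0)=I$; $\mathrm{tr}$ is the sum of diagonal entries. Hill's equation is called stable if this linear system is stable, i.e. its zero solution is Lyapunov stable: with $\|\boldsymbol{\eta}\|=\sum_k|\eta_k|$ and initial time $t_0$, for every $\epsilon>0$ there is $\delta>0$ such that every solution with $\|\boldsymbol{x}(t_0)\|<\delta$ satisfies $\|\boldsymbol{x}(t)\|<\epsilon$ for all $t\ge t_0$. It is unstable if it is not stable. *)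

theory Defs
  imports "HOL-Analysis.Analysis"
begin

section \<open>The real quaternion algebra\<close>

datatype quat = Quat (qre: real) (qi: real) (qj: real) (qk: real)

lemma quat_eq_iff: "p = q \<longleftrightarrow> qre p = qre q \<and> qi p = qi q \<and> qj p = qj q \<and> qk p = qk q"
  by (cases p; cases q) simp

instantiation quat :: real_div_algebra
begin

definition "0 = Quat 0 0 0 0"
definition "1 = Quat 1 0 0 0"
definition "p + q = Quat (qre p + qre q) (qi p + qi q) (qj p + qj q) (qk p + qk q)"
definition "- p = Quat (- qre p) (- qi p) (- qj p) (- qk p)"
definition "p - q = Quat (qre p - qre q) (qi p - qi q) (qj p - qj q) (qk p - qk q)"
definition "r *\<^sub>R p = Quat (r * qre p) (r * qi p) (r * qj p) (r * qk p)"
definition "p * q = Quat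
  (qre p * qre q - qi p * qi q - qj p * qj q - qk p * qk q)
  (qre p * qi q + qi p * qre q + qj p * qk q - qk p * qj q)
  (qre p * qj q - qi p * qk q + qj p * qre q + qk p * qi q)
  (qre p * qk q + qi p * qj q - qj p * qi q + qk p * qre q)"
definition "inverse p = (let n = (qre p)\<^sup>2 + (qi p)\<^sup>2 + (qj p)\<^sup>2 + (qk p)\<^sup>2
  in Quat (qre p / n) (- qi p / n) (- qj p / n) (- qk p / n))"
definition "p div (q :: quat) = p * inverse q"

lemmas quat_ops_defs = zero_quat_def one_quat_def plus_quat_def uminus_quat_def minus_quat_def
  scaleR_quat_def times_quat_def

instance
proof
  fix p :: quat
  assume "p \<noteq> 0"
  then have "(qre p)\<^sup>2 + (qi p)\<^sup>2 + (qj p)\<^sup>2 + (qk p)\<^sup>2 \<noteq> 0"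
    by (simp add: quat_eq_iff zero_quat_def add_nonneg_eq_0_iff)
  then show "inverse p * p = 1" "p * inverse p = 1"
    by (simp_all add: quat_eq_iff one_quat_def times_quat_def inverse_quat_def Let_def
        add_divide_distrib [symmetric] diff_divide_distrib [symmetric] power2_eq_square
        algebra_simps)
qed (simp_all add: quat_eq_iff quat_ops_defs divide_quat_def inverse_quat_def algebra_simps)

end

lemma quat_sel_simps [simp]:
  "qre 0 = 0" "qi 0 = 0" "qj 0 = 0" "qk 0 = 0"
  "qre 1 = 1" "qi 1 = 0" "qj 1 = 0" "qk 1 = 0"
  "qre (p + q) = qre p + qre q" "qi (p + q) = qi p + qi q"
  "qj (p + q) = qj p + qj q" "qk (p + q) = qk p + qk q"
  "qre (- p) = - qre p" "qi (- p) = - qi p" "qj (- p) = - qj p" "qk (- p) = - qk p"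
  "qre (p - q) = qre p - qre q" "qi (p - q) = qi p - qi q"
  "qj (p - q) = qj p - qj q" "qk (p - q) = qk p - qk q"
  "qre (r *\<^sub>R p) = r * qre p" "qi (r *\<^sub>R p) = r * qi p"
  "qj (r *\<^sub>R p) = r * qj p" "qk (r *\<^sub>R p) = r * qk p"
  by (simp_all add: quat_ops_defs)

instantiation quat :: real_inner
begin

definition "inner p q = qre p * qre q + qi p * qi q + qj p * qj q + qk p * qk q"
definition "norm (p :: quat) = sqrt (inner p p)"
definition "sgn (p :: quat) = p /\<^sub>R norm p"
definition "dist (p :: quat) q = norm (p - q)"
definition [code del]:
  "(uniformity :: (quat \<times> quat) filter) = (INF e\<in>{0 <..}. principal {(x, y). dist x y < e})"
definition [code del]:
  "open (U :: quat set) \<longleftrightarrow> (\<forall>x\<in>U. eventually (\<lambda>(x', y). x' = x \<longrightarrow> y \<in> U) uniformity)"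

instance
proof
  fix p :: quat
  have "inner p p = (qre p)\<^sup>2 + (qi p)\<^sup>2 + (qj p)\<^sup>2 + (qk p)\<^sup>2"
    by (simp add: inner_quat_def power2_eq_square)
  then show "0 \<le> inner p p" "inner p p = 0 \<longleftrightarrow> p = 0"
    by (simp_all add: quat_eq_iff add_nonneg_eq_0_iff)
qed (simp_all add: inner_quat_def norm_quat_def sgn_quat_def dist_quat_def uniformity_quat_def
    open_quat_def algebra_simps)

end

instance quat :: real_normed_div_algebra
proof
  fix p q :: quat
  have "inner (p * q) (p * q) = inner p p * inner q q"
    by (simp add: inner_quat_def times_quat_def algebra_simps)
  then show "norm (p * q) = norm p * norm q"
    by (simp add: norm_quat_def real_sqrt_mult)
qed


section \<open>Linear systems over the quaternions and Hill's equation\<close>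

text \<open>Since \<open>*v\<close> and \<open>**\<close> multiply the matrix entries from the left, coefficients act on
  solutions by left multiplication.\<close>

definition solves_linear_system :: "(real \<Rightarrow> quat^2^2) \<Rightarrow> (real \<Rightarrow> quat^2) \<Rightarrow> bool" where
  "solves_linear_system A x \<longleftrightarrow> (\<forall>t. (x has_vector_derivative A t *v x t) (at t))"

definition principal_fundamental_matrix ::
    "(real \<Rightarrow> quat^2^2) \<Rightarrow> real \<Rightarrow> (real \<Rightarrow> quat^2^2) \<Rightarrow> bool" where
  "principal_fundamental_matrix A t0 M \<longleftrightarrow>
     (\<forall>t. (M has_vector_derivative A t ** M t) (at t)) \<and> M t0 = mat 1"

definition norm_sum :: "quat^2 \<Rightarrow> real" where
  "norm_sum x = (\<Sum>k\<in>UNIV. norm (x $ k))"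

definition lyapunov_stable :: "(real \<Rightarrow> quat^2^2) \<Rightarrow> real \<Rightarrow> bool" where
  "lyapunov_stable A t0 \<longleftrightarrow>
     (\<forall>\<epsilon>>0. \<exists>\<delta>>0. \<forall>x. solves_linear_system A x \<and> norm_sum (x t0) < \<delta> \<longrightarrow>
        (\<forall>t\<ge>t0. norm_sum (x t) < \<epsilon>))"

definition hill_matrix :: "(real \<Rightarrow> quat) \<Rightarrow> real \<Rightarrow> quat^2^2" where
  "hill_matrix a t = vector [vector [0, 1], vector [- a t, 0]]"

definition hill_stable :: "(real \<Rightarrow> quat) \<Rightarrow> real \<Rightarrow> bool" where
  "hill_stable a t0 \<longleftrightarrow> lyapunov_stable (hill_matrix a) t0"

abbreviation hill_unstable :: "(real \<Rightarrow> quat) \<Rightarrow> real \<Rightarrow> bool" where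
  "hill_unstable a t0 \<equiv> \<not> hill_stable a t0"

end

theory Submission
  imports Defs
begin

text \<open>
  Stability forces the monodromy matrix \<open>P = M T\<close> to be an isometry of a positive definite
  quaternionic Hermitian form, and for isometries the trace criterion is the Cauchy-Schwarz inequality.

  A stable equation has a bounded fundamental matrix on \<open>[t0, \<infinity>)\<close>
  (\<open>hill_stable_imp_bounded\<close>). The Study determinant, the quaternionic substitute for the determinant,
  is constant equal to 1 along the flow, so the inverse of \<open>M t\<close> is the matrix of cubic polynomials
  \<open>study_adj (M t)\<close> (\<open>hill_fundamental_inverse\<close>), and it is bounded together with \<open>M t\<close>. The explicit
  inverse also yields uniqueness of solutions (\<open>hill_solution_unique\<close>) and thereby the relation
  \<open>M (t + T) = M t ** P\<close> (\<open>hill_monodromy\<close>). Averaging the forms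
  \<open>x \<mapsto> \<bar>M (t0 + n T) x\<bar>\<^sup>2\<close> over \<open>n\<close> and passing to a limit gives a
  positive definite form \<open>H\<close> preserved by \<open>P\<close> (\<open>bounded_cocycle_invariant_form\<close>).

  Factoring \<open>H = ctranspose S ** S\<close>, the conjugate \<open>U = S P S\<^sup>-\<^sup>1\<close> is unitary and has the same
  scalar trace as \<open>P\<close>. From \<open>\<bar>U - 1\<bar>\<^sup>2 = 4 - 2 qre (trace P)\<close> one reads off that
  \<open>qre (trace P) \<le> 2\<close>, with equality only for \<open>P = 1\<close> (\<open>isometry_trace\<close>); the same for \<open>- P\<close> gives
  the lower bound. Conversely, \<open>P = 1\<close> or \<open>P = - 1\<close> makes \<open>M\<close> periodic with period \<open>2 T\<close>, hence
  bounded, and a bounded fundamental matrix implies stability (\<open>hill_stable_if_bounded\<close>).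
\<close>

section \<open>Quaternionic conjugation\<close>

definition qconj :: "quat \<Rightarrow> quat" where
  "qconj p = Quat (qre p) (- qi p) (- qj p) (- qk p)"

lemma qconj_sel [simp]:
  "qre (qconj p) = qre p" "qi (qconj p) = - qi p" "qj (qconj p) = - qj p" "qk (qconj p) = - qk p"
  by (simp_all add: qconj_def)

lemma quat_mult_sel:
  "qre (p * q) = qre p * qre q - qi p * qi q - qj p * qj q - qk p * qk q"
  "qi (p * q) = qre p * qi q + qi p * qre q + qj p * qk q - qk p * qj q"
  "qj (p * q) = qre p * qj q - qi p * qk q + qj p * qre q + qk p * qi q"
  "qk (p * q) = qre p * qk q + qi p * qj q - qj p * qi q + qk p * qre q"
  by (simp_all add: times_quat_def)

lemma quat_of_real_sel [simp]:
  "qre (of_real r) = r" "qi (of_real r) = 0" "qj (of_real r) = 0" "qk (of_real r) = 0"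
  by (simp_all add: of_real_def)

lemma qconj_mult: "qconj (p * q) = qconj q * qconj p"
  by (simp add: quat_eq_iff quat_mult_sel algebra_simps)

lemma qconj_simps [simp]:
  "qconj (qconj p) = p" "qconj 0 = 0" "qconj 1 = 1" "qconj (of_real r) = of_real r"
  "qconj (p + q) = qconj p + qconj q" "qconj (p - q) = qconj p - qconj q"
  "qconj (- p) = - qconj p" "qconj (r *\<^sub>R p) = r *\<^sub>R qconj p"
  by (simp_all add: quat_eq_iff)

lemma mult_qconj_self: "p * qconj p = of_real (p \<bullet> p)" "qconj p * p = of_real (p \<bullet> p)"
  by (simp_all add: quat_eq_iff quat_mult_sel inner_quat_def)

lemma inner_qconj_mult: "p \<bullet> (qconj a * q) = (a * p) \<bullet> q"
  by (simp add: quat_mult_sel inner_quat_def algebra_simps)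

lemma qre_mult_commute: "qre (p * q) = qre (q * p)"
  by (simp add: quat_mult_sel)

lemma inner_quat_qre: "p \<bullet> q = qre (qconj p * q)"
  by (simp add: quat_mult_sel inner_quat_def)

lemma norm_qconj [simp]: "norm (qconj p) = norm p"
  by (simp add: norm_quat_def inner_quat_def)

lemma bounded_linear_qconj: "bounded_linear qconj"
  by (rule bounded_linear_intro[where K = 1]) simp_all

lemma quat_self_conj_eq: "qconj p = p \<Longrightarrow> p = of_real (qre p)"
  by (simp add: quat_eq_iff)

text \<open>Compactness of bounded sets is needed twice: to extract a limit of averaged forms, and to bound a
  continuous function of a bounded sequence of matrices. It is inherited from \<open>\<real>\<^sup>4\<close>.\<close>

instance quat :: heine_borel
proof
  fix f :: "nat \<Rightarrow> quat"
  assume bd: "bounded (range f)"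
  define \<phi> where "\<phi> p = ((qre p, qi p), (qj p, qk p))" for p
  define \<psi> where "\<psi> z = Quat (fst (fst z)) (snd (fst z)) (fst (snd z)) (snd (snd z))"
    for z :: "(real \<times> real) \<times> (real \<times> real)"
  have n\<phi>: "norm (\<phi> p) = norm p" for p
    by (simp add: \<phi>_def norm_quat_def norm_prod_def inner_quat_def power2_eq_square)
  have n\<psi>: "norm (\<psi> z) = norm z" for z
    by (cases z) (auto simp: \<psi>_def norm_quat_def norm_prod_def inner_quat_def power2_eq_square)
  have "linear \<psi>"
    by (rule linearI) (simp_all add: \<psi>_def quat_ops_defs)
  then have bl: "bounded_linear \<psi>"
    by (intro bounded_linear_intro[where K = 1]) (simp_all only: linear_add linear_cmul n\<psi> mult_1_right order_refl)
  have "bounded (range (\<lambda>n. \<phi> (f n)))"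
    using bd by (auto simp: bounded_iff n\<phi>)
  then obtain l r where r: "strict_mono (r :: nat \<Rightarrow> nat)" and l: "((\<lambda>n. \<phi> (f n)) \<circ> r) \<longlonglongrightarrow> l"
    using bounded_imp_convergent_subsequence by blast
  have "(\<lambda>n. \<psi> (\<phi> (f (r n)))) \<longlonglongrightarrow> \<psi> l"
    using bounded_linear.tendsto[OF bl l] by (simp add: o_def)
  moreover have "\<psi> (\<phi> p) = p" for p
    by (simp add: \<phi>_def \<psi>_def)
  ultimately have "(f \<circ> r) \<longlonglongrightarrow> \<psi> l"
    by (simp add: o_def)
  with r show "\<exists>l r. strict_mono (r :: nat \<Rightarrow> nat) \<and> (f \<circ> r) \<longlonglongrightarrow> l"
    by blast
qed

section \<open>Quaternionic matrices and their adjoints\<close>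

lemma norm_vec_le_sum: "norm (x :: 'a::real_normed_vector ^ 'n) \<le> (\<Sum>i\<in>UNIV. norm (x $ i))"
  by (simp add: norm_vec_def L2_set_le_sum)

lemma bounded_bilinear_matrix_vector_mult:
  "bounded_bilinear ((*v) :: 'a::real_normed_algebra_1 ^ 'n ^ 'm \<Rightarrow> 'a ^ 'n \<Rightarrow> 'a ^ 'm)"
proof
  fix A B :: "'a ^ 'n ^ 'm" and x y :: "'a ^ 'n" and r :: real
  show "(A + B) *v x = A *v x + B *v x" "A *v (x + y) = A *v x + A *v y"
    by (simp_all add: matrix_vector_mult_def vec_eq_iff sum.distrib algebra_simps)
  show "(r *\<^sub>R A) *v x = r *\<^sub>R (A *v x)" "A *v (r *\<^sub>R x) = r *\<^sub>R (A *v x)"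
    by (simp_all add: matrix_vector_mult_def vec_eq_iff scaleR_sum_right)
  show "\<exists>K. \<forall>A x. norm ((A :: 'a ^ 'n ^ 'm) *v x) \<le> norm A * norm x * K"
  proof (intro exI allI)
    fix A :: "'a ^ 'n ^ 'm" and x :: "'a ^ 'n"
    have e: "norm (A $ i $ j * x $ j) \<le> norm A * norm x" for i j
      by (rule order_trans[OF norm_mult_ineq], rule mult_mono)
         (auto intro: order_trans[OF Finite_Cartesian_Product.norm_nth_le] Finite_Cartesian_Product.norm_nth_le)
    have "norm (A *v x) \<le> (\<Sum>i\<in>UNIV. norm ((A *v x) $ i))"
      by (rule norm_vec_le_sum)
    also have "\<dots> \<le> (\<Sum>i\<in>(UNIV::'m set). \<Sum>j\<in>(UNIV::'n set). norm A * norm x)"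
      unfolding matrix_vector_mult_def vec_lambda_beta by (intro sum_mono sum_norm_le e)
    finally show "norm (A *v x) \<le> norm A * norm x * (real CARD('m) * real CARD('n))"
      by (simp add: mult_ac)
  qed
qed

lemma bounded_bilinear_matrix_matrix_mult:
  "bounded_bilinear ((**) :: 'a::real_normed_algebra_1 ^ 'n ^ 'm \<Rightarrow> 'a ^ 'p ^ 'n \<Rightarrow> 'a ^ 'p ^ 'm)"
proof
  fix A A' :: "'a ^ 'n ^ 'm" and B B' :: "'a ^ 'p ^ 'n" and r :: real
  show "(A + A') ** B = A ** B + A' ** B" "A ** (B + B') = A ** B + A ** B'"
    by (simp_all add: matrix_matrix_mult_def vec_eq_iff sum.distrib algebra_simps)
  show "(r *\<^sub>R A) ** B = r *\<^sub>R (A ** B)" "A ** (r *\<^sub>R B) = r *\<^sub>R (A ** B)"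
    by (simp_all add: matrix_matrix_mult_def vec_eq_iff scaleR_sum_right)
  show "\<exists>K. \<forall>A B. norm ((A :: 'a ^ 'n ^ 'm) ** (B :: 'a ^ 'p ^ 'n)) \<le> norm A * norm B * K"
  proof (intro exI allI)
    fix A :: "'a ^ 'n ^ 'm" and B :: "'a ^ 'p ^ 'n"
    have e: "norm (A $ i $ k * B $ k $ j) \<le> norm A * norm B" for i j k
      by (rule order_trans[OF norm_mult_ineq], rule mult_mono)
         (auto intro: order_trans[OF Finite_Cartesian_Product.norm_nth_le Finite_Cartesian_Product.norm_nth_le])
    have "norm (A ** B) \<le> (\<Sum>i\<in>UNIV. norm ((A ** B) $ i))"
      by (rule norm_vec_le_sum)
    also have "\<dots> \<le> (\<Sum>i\<in>UNIV. \<Sum>j\<in>UNIV. norm ((A ** B) $ i $ j))"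
      by (intro sum_mono norm_vec_le_sum)
    also have "\<dots> \<le> (\<Sum>i\<in>(UNIV::'m set). \<Sum>j\<in>(UNIV::'p set). \<Sum>k\<in>(UNIV::'n set). norm A * norm B)"
      unfolding matrix_matrix_mult_def vec_lambda_beta by (intro sum_mono sum_norm_le e)
    finally show "norm (A ** B) \<le> norm A * norm B * (real CARD('m) * real CARD('p) * real CARD('n))"
      by (simp add: mult_ac)
  qed
qed

definition ctranspose :: "quat ^ 'n ^ 'm \<Rightarrow> quat ^ 'm ^ 'n" where
  "ctranspose A = (\<chi> i j. qconj (A $ j $ i))"

lemma ctranspose_mult: "ctranspose (A ** B) = ctranspose B ** ctranspose A"
proof -
  have *: "qconj (sum f S) = (\<Sum>x\<in>S. qconj (f x))" for f :: "'x \<Rightarrow> quat" and S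
    by (rule linear_sum[OF bounded_linear.linear[OF bounded_linear_qconj]])
  then show ?thesis
    by (simp add: ctranspose_def matrix_matrix_mult_def vec_eq_iff qconj_mult *)
qed

lemma ctranspose_ctranspose [simp]: "ctranspose (ctranspose A) = A"
  by (simp add: ctranspose_def vec_eq_iff)

lemma ctranspose_mat_1 [simp]: "ctranspose (mat 1) = mat 1"
  by (simp add: ctranspose_def vec_eq_iff mat_def)

lemma bounded_linear_ctranspose: "bounded_linear (ctranspose :: quat ^ 'n ^ 'm \<Rightarrow> _)"
proof (rule bounded_linear_intro)
  fix A B :: "quat ^ 'n ^ 'm" and r :: real
  show "ctranspose (A + B) = ctranspose A + ctranspose B"
    "ctranspose (r *\<^sub>R A) = r *\<^sub>R ctranspose A"
    by (simp_all add: ctranspose_def vec_eq_iff)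
  have "norm (ctranspose A) \<le> (\<Sum>i\<in>UNIV. norm (ctranspose A $ i))"
    by (rule norm_vec_le_sum)
  also have "\<dots> \<le> (\<Sum>i\<in>UNIV. \<Sum>j\<in>UNIV. norm (ctranspose A $ i $ j))"
    by (intro sum_mono norm_vec_le_sum)
  also have "\<dots> \<le> (\<Sum>i\<in>(UNIV::'n set). \<Sum>j\<in>(UNIV::'m set). norm A)"
    by (intro sum_mono) (auto simp: ctranspose_def intro: order_trans[OF Finite_Cartesian_Product.norm_nth_le Finite_Cartesian_Product.norm_nth_le])
  finally show "norm (ctranspose A) \<le> norm A * (real CARD('n) * real CARD('m))"
    by (simp add: mult_ac)
qed

text \<open>This adjunction is why \<open>ctranspose P ** H ** P = H\<close> says that \<open>P\<close> preserves the form
  \<open>x \<bullet> (H *v x)\<close>.\<close>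

lemma inner_ctranspose: "x \<bullet> (ctranspose A *v y) = (A *v x) \<bullet> y"
proof -
  have "x \<bullet> (ctranspose A *v y) = (\<Sum>i\<in>UNIV. \<Sum>j\<in>UNIV. (A $ j $ i * x $ i) \<bullet> y $ j)"
    by (simp add: inner_vec_def matrix_vector_mult_def ctranspose_def inner_sum_right inner_qconj_mult)
  also have "\<dots> = (\<Sum>j\<in>UNIV. \<Sum>i\<in>UNIV. (A $ j $ i * x $ i) \<bullet> y $ j)"
    by (rule sum.swap)
  finally show ?thesis
    by (simp add: inner_vec_def matrix_vector_mult_def inner_sum_left)
qed

lemma qre_sum: "qre (sum f S) = (\<Sum>x\<in>S. qre (f x))"
  by (induction S rule: infinite_finite_induct) simp_all

lemma inner_matrix_trace: "A \<bullet> B = qre (trace (ctranspose A ** B))"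
  for A B :: "quat ^ 'n ^ 'm"
proof -
  have "A \<bullet> B = (\<Sum>i\<in>UNIV. \<Sum>j\<in>UNIV. qre (qconj (A $ i $ j) * B $ i $ j))"
    by (simp add: inner_vec_def inner_quat_qre)
  also have "\<dots> = (\<Sum>j\<in>UNIV. \<Sum>i\<in>UNIV. qre (qconj (A $ i $ j) * B $ i $ j))"
    by (rule sum.swap)
  finally show ?thesis
    by (simp add: trace_def matrix_matrix_mult_def ctranspose_def qre_sum)
qed

text \<open>Over a noncommutative ring the trace itself is not invariant under conjugation; its scalar part is,
  because scalar parts of products commute. Thus \<open>qre (trace P)\<close> may be computed after a
  change of basis that turns \<open>P\<close> into a unitary matrix.\<close>

lemma qre_trace_mult_commute: "qre (trace (A ** B)) = qre (trace (B ** A))"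
  for A :: "quat ^ 'n ^ 'm" and B :: "quat ^ 'm ^ 'n"
proof -
  have "qre (trace (A ** B)) = (\<Sum>i\<in>UNIV. \<Sum>k\<in>UNIV. qre (B $ k $ i * A $ i $ k))"
    by (simp add: trace_def matrix_matrix_mult_def qre_sum qre_mult_commute[of "A $ _ $ _"])
  also have "\<dots> = (\<Sum>k\<in>UNIV. \<Sum>i\<in>UNIV. qre (B $ k $ i * A $ i $ k))"
    by (rule sum.swap)
  finally show ?thesis
    by (simp add: trace_def matrix_matrix_mult_def qre_sum)
qed

definition mat2 :: "quat \<Rightarrow> quat \<Rightarrow> quat \<Rightarrow> quat \<Rightarrow> quat^2^2" where
  "mat2 a b c d = vector [vector [a, b], vector [c, d]]"

lemma mat2_nth [simp]:
  "mat2 a b c d $ 1 $ 1 = a" "mat2 a b c d $ 1 $ 2 = b"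
  "mat2 a b c d $ 2 $ 1 = c" "mat2 a b c d $ 2 $ 2 = d"
  by (simp_all add: mat2_def)

lemma mat2_eq_iff: "A = B \<longleftrightarrow> A $ 1 $ 1 = B $ 1 $ 1 \<and> A $ 1 $ 2 = B $ 1 $ 2 \<and>
    A $ 2 $ 1 = B $ 2 $ 1 \<and> A $ 2 $ 2 = B $ 2 $ 2"
  for A B :: "'a^2^2"
  by (auto simp: vec_eq_iff forall_2)

lemma mat2_mult: "mat2 a b c d ** mat2 a' b' c' d' =
    mat2 (a * a' + b * c') (a * b' + b * d') (c * a' + d * c') (c * b' + d * d')"
  by (simp add: mat2_eq_iff matrix_matrix_mult_def sum_2)

lemma mat2_one: "mat 1 = mat2 1 0 0 1"
  by (simp add: mat2_eq_iff mat_def)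

lemma mat2_exhaust: obtains a b c d where "A = mat2 a b c d"
proof
  show "A = mat2 (A $ 1 $ 1) (A $ 1 $ 2) (A $ 2 $ 1) (A $ 2 $ 2)"
    by (simp add: mat2_eq_iff)
qed

lemma ctranspose_mat2: "ctranspose (mat2 a b c d) = mat2 (qconj a) (qconj c) (qconj b) (qconj d)"
  by (simp add: mat2_eq_iff ctranspose_def)

section \<open>Isometries of a positive definite Hermitian form\<close>

text \<open>In the Frobenius inner product a unitary \<open>2 \<times> 2\<close> matrix has the same length as the identity, so
  its scalar trace, which is its inner product with the identity, is subject to Cauchy-Schwarz including
  the case of equality.\<close>

lemma norm_unitary_diff_one:
  fixes U :: "quat^2^2"
  assumes "ctranspose U ** U = mat 1"
  shows "norm (U - mat 1) ^ 2 = 4 - 2 * qre (trace U)"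
proof -
  have one: "mat 1 \<bullet> U = qre (trace U)"
    by (simp add: inner_matrix_trace)
  have "qre (trace (mat 1 :: quat^2^2)) = 2"
    using quat_of_real_sel(1)[of 2] by (simp add: trace_def sum_2 mat_def)
  then have "U \<bullet> U = 2" "mat 1 \<bullet> (mat 1 :: quat^2^2) = 2"
    using assms by (simp_all add: inner_matrix_trace)
  then show ?thesis
    unfolding power2_norm_eq_inner using one by (simp add: inner_diff_left inner_diff_right inner_commute)
qed

definition posdef_hermitian :: "quat ^ 'n ^ 'n \<Rightarrow> bool" where
  "posdef_hermitian H \<longleftrightarrow> ctranspose H = H \<and> (\<forall>x. x \<noteq> 0 \<longrightarrow> x \<bullet> (H *v x) > 0)"

text \<open>Over the quaternions the usual Cholesky factor survives, because the diagonal entries of a Hermitian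
  matrix are real and hence central.\<close>

lemma posdef_hermitian_cholesky:
  fixes H :: "quat^2^2"
  assumes "posdef_hermitian H"
  obtains S S' :: "quat^2^2" where "ctranspose S ** S = H" "S ** S' = mat 1" "S' ** S = mat 1"
proof -
  have herm: "ctranspose H = H" and pos: "\<And>x. x \<noteq> 0 \<Longrightarrow> x \<bullet> (H *v x) > 0"
    using assms by (auto simp: posdef_hermitian_def)
  obtain p' r r' s' where H0: "H = mat2 p' r r' s'"
    by (rule mat2_exhaust)
  define p s where "p = qre p'" and "s = qre s'"
  have "p' = of_real p" "s' = of_real s" "r' = qconj r"
    using herm unfolding H0 ctranspose_mat2 p_def s_def
    by (auto simp: mat2_eq_iff intro: quat_self_conj_eq)
  with H0 have H: "H = mat2 (of_real p) r (qconj r) (of_real s)"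
    by simp
  let ?\<delta> = "p * s - r \<bullet> r"
  have q: "vector [x, y] \<bullet> (H *v vector [x, y]) =
      p * (x \<bullet> x) + x \<bullet> (r * y) + y \<bullet> (qconj r * x) + s * (y \<bullet> y)" for x y
    by (simp add: H inner_vec_def matrix_vector_mult_def sum_2 inner_add_right scaleR_conv_of_real[symmetric])
  have ne: "vector [x, y] \<noteq> (0 :: quat^2)" if "x \<noteq> 0 \<or> y \<noteq> 0" for x y
    using that by (auto simp: vec_eq_iff forall_2)
  have p: "p > 0"
    using pos[OF ne[of 1 0]] unfolding q by (simp add: inner_quat_def)
  (* H maps the vector (-r, p) to ?\<delta> times the second unit vector. *)
  have "p * ?\<delta> > 0"
    using pos[OF ne[of "- r" "of_real p"]] p unfolding q
    by (simp add: scaleR_conv_of_real[symmetric] inner_quat_def quat_mult_sel algebra_simps)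
  then have \<delta>: "?\<delta> > 0"
    using p by (simp add: zero_less_mult_iff)
  define w v where "w = sqrt p" and "v = sqrt (?\<delta> / p)"
  have wv: "w > 0" "v > 0" "w * w = p" "v * v = ?\<delta> / p"
    using p \<delta> by (simp_all add: w_def v_def)
  show ?thesis
  proof
    let ?S = "mat2 (of_real w) (r /\<^sub>R w) 0 (of_real v)"
    let ?S' = "mat2 (inverse w *\<^sub>R 1) (- (inverse (w * w * v) *\<^sub>R r)) 0 (inverse v *\<^sub>R 1)"
    have "(r /\<^sub>R w) \<bullet> (r /\<^sub>R w) = (r \<bullet> r) / p"
      by (simp add: divide_inverse flip: wv(3))
    then have "s = (r /\<^sub>R w) \<bullet> (r /\<^sub>R w) + v * v"
      using p by (simp add: wv field_simps)
    then have s: "qconj (r /\<^sub>R w) * (r /\<^sub>R w) + of_real v * of_real v = of_real s"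
      unfolding mult_qconj_self by (simp only: of_real_add of_real_mult)
    have w: "of_real w * of_real w = (of_real p :: quat)" "w \<noteq> 0"
      using wv by (simp_all flip: of_real_mult)
    have "of_real w * (r /\<^sub>R w) = r" "qconj (r /\<^sub>R w) * of_real w = qconj r"
      using w(2) by (simp_all add: quat_eq_iff quat_mult_sel)
    with s w(1) show "ctranspose ?S ** ?S = H"
      unfolding H ctranspose_mat2 mat2_mult mat2_eq_iff mat2_nth by simp
    show "?S ** ?S' = mat 1" "?S' ** ?S = mat 1"
      using w(2) wv(2) unfolding mat2_mult mat2_one mat2_eq_iff mat2_nth
      by (simp_all add: quat_eq_iff quat_mult_sel)
  qed
qed

text \<open>A Cholesky factor of \<open>H\<close> conjugates \<open>P\<close> to a unitary matrix with the same scalar trace.\<close>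

lemma isometry_trace:
  fixes P H :: "quat^2^2"
  assumes H: "posdef_hermitian H" and inv: "ctranspose P ** H ** P = H"
  shows "qre (trace P) \<le> 2" and "qre (trace P) = 2 \<Longrightarrow> P = mat 1"
proof -
  obtain S S' :: "quat^2^2" where S: "ctranspose S ** S = H" "S ** S' = mat 1" "S' ** S = mat 1"
    by (rule posdef_hermitian_cholesky[OF H])
  define U where "U = S ** P ** S'"
  have "ctranspose U ** U = ctranspose S' ** (ctranspose P ** (ctranspose S ** S) ** P) ** S'"
    by (simp add: U_def ctranspose_mult matrix_mul_assoc)
  also have "\<dots> = ctranspose S' ** (ctranspose S ** S) ** S'"
    by (simp only: S inv)
  also have "\<dots> = ctranspose (S ** S') ** (S ** S')"
    by (simp add: ctranspose_mult matrix_mul_assoc)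
  finally have unit: "ctranspose U ** U = mat 1"
    by (simp add: S)
  have "qre (trace U) = qre (trace (S' ** (S ** P)))"
    unfolding U_def by (rule qre_trace_mult_commute)
  then have tr: "qre (trace U) = qre (trace P)"
    by (simp add: matrix_mul_assoc S)
  have n: "norm (U - mat 1) ^ 2 = 4 - 2 * qre (trace P)"
    using norm_unitary_diff_one[OF unit] tr by simp
  show "qre (trace P) \<le> 2"
    using n zero_le_power2[of "norm (U - mat 1)"] by linarith
  assume "qre (trace P) = 2"
  with n have "S ** P ** S' = mat 1"
    by (simp add: U_def)
  then have "S' ** (S ** P ** S') ** S = mat 1"
    by (simp add: S)
  then show "P = mat 1"
    by (simp add: matrix_mul_assoc S) (simp add: S flip: matrix_mul_assoc)
qed

section \<open>An invariant form from bounded orbits\<close>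

text \<open>The forms \<open>G n = ctranspose (X n) ** X n\<close> satisfy \<open>G (Suc n) = ctranspose P ** G n ** P\<close>, so
  the pullback along \<open>P\<close> changes their averages only by a telescoped boundary term divided by the
  number of terms. A limit point of the averages is therefore invariant. The bound on the inverses \<open>Y n\<close>
  keeps all the forms uniformly away from zero, so the limit stays positive definite.\<close>

lemma bounded_cocycle_invariant_form:
  fixes P :: "quat ^ 'n ^ 'n" and X Y :: "nat \<Rightarrow> quat ^ 'n ^ 'n"
  assumes rec: "\<And>n. X (Suc n) = X n ** P"
    and inv: "\<And>n. Y n ** X n = mat 1"
    and bX: "bounded (range X)" and bY: "bounded (range Y)"
  obtains H where "posdef_hermitian H" "ctranspose P ** H ** P = H"
proof -
  note mm = bounded_bilinear_matrix_matrix_mult and mv = bounded_bilinear_matrix_vector_mult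
  note ct = bounded_linear_ctranspose
  interpret m: bounded_bilinear "(**) :: quat^'n^'n \<Rightarrow> quat^'n^'n \<Rightarrow> quat^'n^'n" by (rule mm)
  interpret v: bounded_bilinear "(*v) :: quat^'n^'n \<Rightarrow> quat^'n \<Rightarrow> quat^'n" by (rule mv)
  interpret c: bounded_linear "ctranspose :: quat^'n^'n \<Rightarrow> quat^'n^'n" by (rule ct)
  define G where "G n = ctranspose (X n) ** X n" for n
  have G_Suc: "G (Suc n) = ctranspose P ** G n ** P" for n
    by (simp add: G_def rec ctranspose_mult matrix_mul_assoc)
  have "bounded (range G)"
  proof -
    obtain B where B: "\<And>n. norm (X n) \<le> B"
      using bX by (auto simp: bounded_iff)
    have B0: "B \<ge> 0" using B[of 0] norm_ge_zero order_trans by blast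
    obtain K where K: "K \<ge> 0" "\<And>A B. norm ((A :: quat^'n^'n) ** (B :: quat^'n^'n)) \<le> norm A * norm B * K"
      using m.nonneg_bounded by blast
    obtain L where L: "L \<ge> 0" "\<And>A. norm (ctranspose (A :: quat^'n^'n)) \<le> norm A * L"
      using c.nonneg_bounded by blast
    have "norm (G n) \<le> (B * L) * B * K" for n
    proof -
      have "norm (ctranspose (X n)) \<le> B * L"
        using L(2)[of "X n"] mult_right_mono[OF B[of n] L(1)] by linarith
      then have "norm (ctranspose (X n)) * norm (X n) * K \<le> (B * L) * B * K"
        using K(1) L(1) B0 by (intro mult_right_mono mult_mono B) auto
      then show ?thesis
        using K(2)[of "ctranspose (X n)" "X n"] by (simp add: G_def)
    qed
    then show ?thesis by (auto simp: bounded_iff)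
  qed
  then obtain C where C: "\<And>n. norm (G n) \<le> C"
    by (auto simp: bounded_iff)
  define h where "h N = (1 / real (Suc N)) *\<^sub>R (\<Sum>n\<le>N. G n)" for N
  have "norm (h N) \<le> C" for N
  proof -
    have "norm (\<Sum>n\<le>N. G n) \<le> (\<Sum>n\<le>N. C)"
      by (rule sum_norm_le) (rule C)
    then show ?thesis
      by (simp add: h_def field_simps)
  qed
  then have "bounded (range h)"
    by (auto simp: bounded_iff)
  then obtain H r where r: "strict_mono (r :: nat \<Rightarrow> nat)" and lim: "(h \<circ> r) \<longlonglongrightarrow> H"
    using bounded_imp_convergent_subsequence by blast
  have lim: "(\<lambda>k. h (r k)) \<longlonglongrightarrow> H"
    using lim by (simp add: o_def)
  obtain K where K: "K > 0" "\<And>A x. norm ((A :: quat^'n^'n) *v x) \<le> norm A * norm x * K"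
    using v.pos_bounded by blast
  obtain B where B: "B > 0" "\<And>n. norm (Y n) \<le> B"
    using bY by (auto simp: bounded_pos)
  define c where "c = 1 / (B * K)\<^sup>2"
  have c: "c > 0" using B K by (simp add: c_def)
  have Gc: "x \<bullet> (G n *v x) \<ge> c * (norm x)\<^sup>2" for n x
  proof -
    have "norm x = norm (Y n *v (X n *v x))"
      by (simp add: matrix_vector_mul_assoc inv)
    also have "\<dots> \<le> norm (Y n) * norm (X n *v x) * K"
      by (rule K)
    also have "\<dots> \<le> B * norm (X n *v x) * K"
      using K by (intro mult_right_mono B) auto
    finally have "norm x \<le> (B * K) * norm (X n *v x)"
      by (simp add: mult_ac)
    then have "(norm x)\<^sup>2 \<le> ((B * K) * norm (X n *v x))\<^sup>2"
      by (rule power_mono) simp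
    moreover have "x \<bullet> (G n *v x) = (norm (X n *v x))\<^sup>2"
      by (simp add: G_def flip: matrix_vector_mul_assoc) (simp add: inner_ctranspose power2_norm_eq_inner)
    ultimately show ?thesis
      using B K by (simp add: c_def power_mult_distrib field_simps)
  qed
  have hc: "x \<bullet> (h N *v x) \<ge> c * (norm x)\<^sup>2" for N x
  proof -
    have "(\<Sum>n\<le>N. c * (norm x)\<^sup>2) \<le> (\<Sum>n\<le>N. x \<bullet> (G n *v x))"
      by (intro sum_mono Gc)
    also have "\<dots> = x \<bullet> ((\<Sum>n\<le>N. G n) *v x)"
      by (simp add: v.sum_left inner_sum_right)
    finally show ?thesis
      by (simp add: h_def v.scaleR_left field_simps)
  qed
  show ?thesis
  proof
    have "ctranspose (h N) = h N" for N
      by (simp add: h_def c.scaleR c.sum G_def ctranspose_mult)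
    then have "ctranspose H = H"
      using c.tendsto[OF lim] lim by (auto intro: LIMSEQ_unique)
    moreover have "x \<bullet> (H *v x) > 0" if "x \<noteq> 0" for x :: "quat^'n"
    proof -
      have "(\<lambda>k. x \<bullet> (h (r k) *v x)) \<longlonglongrightarrow> x \<bullet> (H *v x)"
        by (intro tendsto_inner tendsto_const v.tendsto lim)
      then have "x \<bullet> (H *v x) \<ge> c * (norm x)\<^sup>2"
        by (rule LIMSEQ_le_const) (use hc in blast)
      moreover have "c * (norm x)\<^sup>2 > 0"
        using c \<open>x \<noteq> 0\<close> by simp
      ultimately show "x \<bullet> (H *v x) > 0"
        by linarith
    qed
    ultimately show "posdef_hermitian H"
      by (simp add: posdef_hermitian_def)
  next
    have tel: "ctranspose P ** h N ** P - h N = (1 / real (Suc N)) *\<^sub>R (G (Suc N) - G 0)" for N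
    proof -
      have "ctranspose P ** h N ** P = (1 / real (Suc N)) *\<^sub>R (\<Sum>n\<le>N. G (Suc n))"
        by (simp add: h_def m.scaleR_right m.scaleR_left m.sum_right m.sum_left G_Suc)
      moreover have "(\<Sum>n\<le>N. G (Suc n)) - (\<Sum>n\<le>N. G n) = G (Suc N) - G 0"
        by (induction N) (simp_all add: algebra_simps)
      ultimately show ?thesis
        by (simp add: h_def flip: scaleR_diff_right)
    qed
    have "(\<lambda>N. (1 / real (Suc N)) *\<^sub>R (G (Suc N) - G 0)) \<longlonglongrightarrow> 0"
    proof (rule Lim_null_comparison)
      show "\<forall>\<^sub>F N in sequentially. norm ((1 / real (Suc N)) *\<^sub>R (G (Suc N) - G 0)) \<le> 2 * C * inverse (real (Suc N))"
      proof (intro always_eventually allI)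
        fix N
        have "norm (G (Suc N) - G 0) \<le> 2 * C"
          using norm_triangle_ineq4[of "G (Suc N)" "G 0"] C[of "Suc N"] C[of 0] by linarith
        then show "norm ((1 / real (Suc N)) *\<^sub>R (G (Suc N) - G 0)) \<le> 2 * C * inverse (real (Suc N))"
          unfolding norm_scaleR using mult_left_mono[of _ _ "inverse (real (Suc N))"]
          by (simp add: divide_inverse mult.commute)
      qed
      show "(\<lambda>N. 2 * C * inverse (real (Suc N))) \<longlonglongrightarrow> 0"
        using tendsto_mult_left[OF LIMSEQ_inverse_real_of_nat, of "2 * C"] by simp
    qed
    then have "(\<lambda>N. ctranspose P ** h N ** P - h N) \<longlonglongrightarrow> 0"
      by (simp add: tel)
    then have "(\<lambda>k. ctranspose P ** h (r k) ** P - h (r k)) \<longlonglongrightarrow> 0"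
      using LIMSEQ_subseq_LIMSEQ[OF _ r] by (fastforce simp: o_def)
    moreover have "(\<lambda>k. ctranspose P ** h (r k) ** P - h (r k)) \<longlonglongrightarrow> ctranspose P ** H ** P - H"
      by (intro tendsto_diff m.tendsto tendsto_const lim)
    ultimately show "ctranspose P ** H ** P = H"
      using LIMSEQ_unique by fastforce
  qed
qed

section \<open>The Study determinant\<close>

text \<open>For \<open>M = (a, b; c, d)\<close> with \<open>a \<noteq> 0\<close> this is \<open>\<bar>a\<bar>\<^sup>2 \<bar>d - c a\<^sup>-\<^sup>1 b\<bar>\<^sup>2\<close>, the determinant of the complex
  \<open>4 \<times> 4\<close> matrix representing \<open>M\<close>; written as a polynomial it needs no case distinction.\<close>

definition study_det :: "quat^2^2 \<Rightarrow> real" where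
  "study_det M = (let a = M $ 1 $ 1; b = M $ 1 $ 2; c = M $ 2 $ 1; d = M $ 2 $ 2 in
     (a \<bullet> a) * (d \<bullet> d) + (b \<bullet> b) * (c \<bullet> c) - 2 * ((d * qconj b) \<bullet> (c * qconj a)))"

text \<open>For invertible \<open>M\<close> this is \<open>study_det M\<close> times the inverse. Its entries are cubic polynomials in
  those of \<open>M\<close> and their conjugates, so bounds and differentiability pass from \<open>M\<close> to the inverse.\<close>

definition study_adj :: "quat^2^2 \<Rightarrow> quat^2^2" where
  "study_adj M = (let a = M $ 1 $ 1; b = M $ 1 $ 2; c = M $ 2 $ 1; d = M $ 2 $ 2 in
     mat2 (qconj a * (d * qconj d) - qconj c * d * qconj b)
          (qconj c * (b * qconj b) - qconj a * b * qconj d)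
          (qconj b * (c * qconj c) - qconj d * c * qconj a)
          (qconj d * (a * qconj a) - qconj b * a * qconj c))"

lemma study_adj_inverse:
  "study_adj M ** M = mat (of_real (study_det M))" "M ** study_adj M = mat (of_real (study_det M))"
proof -
  obtain a b c d where M: "M = mat2 a b c d"
    by (rule mat2_exhaust)
  have mat: "mat k = mat2 k 0 0 k" for k
    by (simp add: mat2_eq_iff mat_def)
  have sc: "qconj p * (p * x) = (p \<bullet> p) *\<^sub>R x" "p * (qconj p * x) = (p \<bullet> p) *\<^sub>R x"
    "qconj p * p = (p \<bullet> p) *\<^sub>R 1" "p * qconj p = (p \<bullet> p) *\<^sub>R 1" for p x
    by (simp_all add: mult_qconj_self scaleR_conv_of_real flip: mult.assoc)
  define k where "k = 2 * ((d * qconj b) \<bullet> (c * qconj a))"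
  have z: "z = k *\<^sub>R 1 - qconj z" if "k = 2 * qre z" for z
    using that by (simp add: quat_eq_iff)
  (* Scalar parts are invariant under conjugation and under rotation of a product, so these four
     products have the same scalar part k / 2. Each of them plus its conjugate is then the real
     number k, which removes all mixed terms below. *)
  have kk: "k = 2 * qre (qconj c * (d * (qconj b * a)))" "k = 2 * qre (qconj d * (c * (qconj a * b)))"
    "k = 2 * qre (a * (qconj c * (d * qconj b)))" "k = 2 * qre (c * (qconj a * (b * qconj d)))"
    unfolding k_def by (simp_all add: inner_quat_def quat_mult_sel) (simp_all add: algebra_simps)
  note z4 = kk[THEN z]
  have D: "study_det M = (a \<bullet> a) * (d \<bullet> d) + (b \<bullet> b) * (c \<bullet> c) - k"
    by (simp add: M study_det_def Let_def k_def)
  show "study_adj M ** M = mat (of_real (study_det M))"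
    unfolding D unfolding M study_adj_def Let_def mat2_nth mat2_mult mat mat2_eq_iff
    using z4(1,2)
    by (simp add: left_diff_distrib right_diff_distrib mult.assoc sc of_real_def scaleR_diff_left scaleR_add_left qconj_mult
      mult.commute[of "d \<bullet> d" "a \<bullet> a"] mult.commute[of "c \<bullet> c" "b \<bullet> b"])
  show "M ** study_adj M = mat (of_real (study_det M))"
    unfolding D unfolding M study_adj_def Let_def mat2_nth mat2_mult mat mat2_eq_iff
    using z4(3,4)
    by (simp add: left_diff_distrib right_diff_distrib mult.assoc sc of_real_def scaleR_diff_left scaleR_add_left qconj_mult
      mult.commute[of "d \<bullet> d" "a \<bullet> a"] mult.commute[of "c \<bullet> c" "b \<bullet> b"])
qed

text \<open>For matrices of Study determinant 1 a bound on the matrices is thus also a bound on their inverses.\<close>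

lemma bounded_study_adj_range:
  assumes "bounded (range X)"
  shows "bounded (range (\<lambda>n. study_adj (X n)))"
proof -
  note qc = bounded_linear.continuous_on[OF bounded_linear_qconj]
  have "continuous_on UNIV (\<lambda>M. study_adj M $ i $ j)" for i j
    by (insert exhaust_2[of i] exhaust_2[of j], elim disjE; simp add: study_adj_def Let_def;
        intro continuous_intros qc)
  then have "continuous_on UNIV (\<lambda>M. \<chi> i j. study_adj M $ i $ j)"
    by (intro continuous_on_vec_lambda)
  then have "continuous_on (closure (range X)) study_adj"
    using continuous_on_subset by (auto simp: vec_lambda_eta)
  then have "bounded (study_adj ` closure (range X))"
    using assms by (intro compact_imp_bounded compact_continuous_image) (simp_all add: compact_closure)
  then show ?thesis
    by (rule bounded_subset) (use closure_subset[of "range X"] in auto)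
qed

section \<open>The fundamental matrix of Hill's equation\<close>

lemma has_vector_derivative_vecI:
  fixes f :: "real \<Rightarrow> 'a::real_normed_vector ^ 'n"
  assumes "\<And>i. ((\<lambda>t. f t $ i) has_vector_derivative f' $ i) (at t within S)"
  shows "(f has_vector_derivative f') (at t within S)"
  using assms unfolding has_vector_derivative_def has_derivative_within
  by (auto intro!: vec_tendstoI bounded_linear_scaleR_left)

lemma hill_matrix_mat2: "hill_matrix a t = mat2 0 1 (- a t) 0"
  by (simp add: hill_matrix_def mat2_def)

text \<open>Liouville's formula: the coefficient matrix has zero diagonal, so the Study determinant is constant
  along the flow. The adjugate is differentiable because it is polynomial; differentiating the
  relation with its inverse then determines the derivative.\<close>

lemma hill_study_det_adj_derivative:
  fixes q :: quat
  assumes M: "(M has_vector_derivative (mat2 0 1 (- q) 0 ** M t)) (at t)"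
  shows "((\<lambda>t. study_det (M t)) has_real_derivative 0) (at t)"
    and "\<exists>D. ((\<lambda>t. study_adj (M t)) has_vector_derivative D) (at t)"
proof -
  let ?a = "\<lambda>t. M t $ 1 $ 1" and ?b = "\<lambda>t. M t $ 1 $ 2"
  let ?c = "\<lambda>t. M t $ 2 $ 1" and ?d = "\<lambda>t. M t $ 2 $ 2"
  have nth: "((\<lambda>t. M t $ i $ j) has_vector_derivative (mat2 0 1 (- q) 0 ** M t) $ i $ j) (at t)" for i j
    by (intro bounded_linear.has_vector_derivative[OF bounded_linear_vec_nth] M)
  have e: "(?a has_vector_derivative ?c t) (at t)" "(?b has_vector_derivative ?d t) (at t)"
    "(?c has_vector_derivative - q * ?a t) (at t)" "(?d has_vector_derivative - q * ?b t) (at t)"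
    using nth[of 1 1] nth[of 1 2] nth[of 2 1] nth[of 2 2]
    by (simp_all add: matrix_matrix_mult_def sum_2)
  note rules = has_vector_derivative_diff has_vector_derivative_add has_vector_derivative_mult_right
    bounded_bilinear.has_vector_derivative[OF bounded_bilinear_inner] has_vector_derivative_mult
    bounded_linear.has_vector_derivative[OF bounded_linear_qconj] e
  have "((\<lambda>t. study_det (M t)) has_vector_derivative 0) (at t)"
    unfolding study_det_def Let_def
  proof (rule has_vector_derivative_eq_rhs, (rule rules)+)
  qed (simp add: inner_quat_def quat_mult_sel, simp add: algebra_simps)
  then show "((\<lambda>t. study_det (M t)) has_real_derivative 0) (at t)"
    by (simp add: has_real_derivative_iff_has_vector_derivative)
  have "\<exists>D. ((\<lambda>t. study_adj (M t) $ i $ j) has_vector_derivative D) (at t)" for i j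
    by (insert exhaust_2[of i] exhaust_2[of j], elim disjE; simp add: study_adj_def Let_def; intro exI; (rule rules)+)
  then obtain D where "((\<lambda>t. study_adj (M t) $ i $ j) has_vector_derivative D i j) (at t)" for i j
    by metis
  then have "((\<lambda>t. study_adj (M t)) has_vector_derivative (\<chi> i j. D i j)) (at t)"
    by (intro has_vector_derivative_vecI) simp
  then show "\<exists>D. ((\<lambda>t. study_adj (M t)) has_vector_derivative D) (at t)" ..
qed

lemma hill_fundamental_inverse:
  assumes "principal_fundamental_matrix (hill_matrix a) t0 M"
  shows "study_adj (M t) ** M t = mat 1" and "M t ** study_adj (M t) = mat 1"
proof -
  have "\<forall>t. ((\<lambda>t. study_det (M t)) has_real_derivative 0) (at t)"
    using assms by (auto simp: principal_fundamental_matrix_def hill_matrix_mat2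
      intro: hill_study_det_adj_derivative)
  then have "study_det (M t) = study_det (M t0)"
    by (rule DERIV_isconst_all)
  also have "\<dots> = 1"
    using assms by (simp add: principal_fundamental_matrix_def study_det_def mat_def inner_quat_def)
  finally show "study_adj (M t) ** M t = mat 1" "M t ** study_adj (M t) = mat 1"
    by (simp_all add: study_adj_inverse)
qed

text \<open>Since \<open>N = M\<^sup>-\<^sup>1\<close> satisfies \<open>N' = - N A\<close>, the product \<open>N x\<close> is constant for every solution \<open>x\<close>.
  This variation-of-constants argument gives uniqueness without a Gronwall estimate.\<close>

lemma hill_solution_unique:
  assumes M: "principal_fundamental_matrix (hill_matrix a) t0 M"
    and x: "solves_linear_system (hill_matrix a) x"
  shows "x t = M t *v (study_adj (M s) *v x s)"
proof -
  note mm = bounded_bilinear.has_vector_derivative[OF bounded_bilinear_matrix_matrix_mult]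
  note mv = bounded_bilinear.has_vector_derivative[OF bounded_bilinear_matrix_vector_mult]
  note inv = hill_fundamental_inverse[OF M]
  define N where "N t = study_adj (M t)" for t
  let ?A = "hill_matrix a"
  have M': "(M has_vector_derivative ?A t ** M t) (at t)" for t
    using M by (simp add: principal_fundamental_matrix_def)
  have N': "(N has_vector_derivative - (N t ** ?A t)) (at t)" for t
  proof -
    obtain D where D: "(N has_vector_derivative D) (at t)"
      unfolding N_def using hill_study_det_adj_derivative(2) M'[of t] unfolding hill_matrix_mat2 by blast
    have "((\<lambda>t. N t ** M t) has_vector_derivative (N t ** (?A t ** M t) + D ** M t)) (at t)"
      by (rule mm[OF D M'])
    moreover have "((\<lambda>t. N t ** M t) has_vector_derivative 0) (at t)"
      by (simp add: N_def inv)
    ultimately have "(N t ** ?A t + D) ** M t = 0"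
      by (simp add: bounded_bilinear.add_left[OF bounded_bilinear_matrix_matrix_mult] matrix_mul_assoc
        vector_derivative_unique_at)
    then have "(N t ** ?A t + D) ** (M t ** N t) = 0"
      by (simp add: matrix_mul_assoc bounded_bilinear.zero_left[OF bounded_bilinear_matrix_matrix_mult])
    then have "D = - (N t ** ?A t)"
      by (simp add: N_def inv add_eq_0_iff2 add.commute)
    with D show ?thesis by simp
  qed
  have "((\<lambda>t. N t *v x t) has_vector_derivative 0) (at t)" for t
  proof -
    have "((\<lambda>t. N t *v x t) has_vector_derivative
        (N t *v (?A t *v x t) + (- (N t ** ?A t)) *v x t)) (at t)"
      using x by (intro mv N') (simp add: solves_linear_system_def)
    then show ?thesis
      by (simp add: matrix_vector_mul_assoc bounded_bilinear.minus_left[OF bounded_bilinear_matrix_vector_mult])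
  qed
  then have "N t *v x t = N s *v x s"
    using has_vector_derivative_zero_constant[of UNIV "\<lambda>t. N t *v x t"] by (metis UNIV_I convex_UNIV)
  then have "M t *v (N t *v x t) = M t *v (N s *v x s)"
    by simp
  then show ?thesis
    by (simp add: N_def matrix_vector_mul_assoc inv)
qed

lemma fundamental_matrix_solves:
  assumes "principal_fundamental_matrix A t0 M"
  shows "solves_linear_system A (\<lambda>t. M t *v c)"
  unfolding solves_linear_system_def
proof
  fix t
  have "((\<lambda>t. M t *v c) has_vector_derivative (M t *v 0 + (A t ** M t) *v c)) (at t)"
    using assms
    by (intro bounded_bilinear.has_vector_derivative[OF bounded_bilinear_matrix_vector_mult])
      (simp_all add: principal_fundamental_matrix_def)
  then show "((\<lambda>t. M t *v c) has_vector_derivative A t *v (M t *v c)) (at t)"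
    by (simp add: matrix_vector_mul_assoc)
qed

lemma solves_linear_system_shift:
  assumes "solves_linear_system A x" and "\<And>t. A (t + T) = A t"
  shows "solves_linear_system A (\<lambda>t. x (t + T))"
  unfolding solves_linear_system_def
proof
  fix t
  have "((\<lambda>t. t + T) has_vector_derivative 1) (at t)"
    by (auto intro!: derivative_eq_intros)
  then have "(x \<circ> (\<lambda>t. t + T) has_vector_derivative 1 *\<^sub>R (A (t + T) *v x (t + T))) (at t)"
    using assms(1) by (intro vector_diff_chain_at) (auto simp: solves_linear_system_def)
  then show "((\<lambda>t. x (t + T)) has_vector_derivative A t *v x (t + T)) (at t)"
    by (simp add: assms(2) o_def)
qed

lemma hill_monodromy:
  assumes M: "principal_fundamental_matrix (hill_matrix a) 0 M" and per: "\<And>t. a (t + T) = a t"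
  shows "M (t + T) = M t ** M T"
proof -
  have "M (t + T) *v c = (M t ** M T) *v c" for c
  proof -
    have "solves_linear_system (hill_matrix a) (\<lambda>t. M (t + T) *v c)"
      by (rule solves_linear_system_shift[OF fundamental_matrix_solves[OF M]])
        (simp add: hill_matrix_def per)
    from hill_solution_unique[OF M this, of t 0] show ?thesis
      using hill_fundamental_inverse(1)[OF M, of 0] M
      by (simp add: principal_fundamental_matrix_def matrix_vector_mul_assoc)
  qed
  then show ?thesis
    by (simp add: matrix_eq)
qed

section \<open>Stability and boundedness of the fundamental matrix\<close>

lemma norm_sum_bounds: "norm x \<le> norm_sum x" "norm_sum x \<le> 2 * norm x"
  unfolding norm_sum_def
  using Finite_Cartesian_Product.norm_nth_le[of x 1] Finite_Cartesian_Product.norm_nth_le[of x 2]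
  by (simp_all only: norm_vec_le_sum) (simp add: sum_2)

text \<open>Solutions may be scaled: testing stability for \<open>\<epsilon> = 1\<close> on small multiples of the unit vectors bounds
  each column of \<open>M(t) M(t0)\<^sup>-\<^sup>1\<close>.\<close>

lemma hill_stable_imp_bounded:
  assumes M: "principal_fundamental_matrix (hill_matrix a) s M" and st: "hill_stable a t0"
  shows "\<exists>B. \<forall>t\<ge>t0. norm (M t) \<le> B"
proof -
  note inv = hill_fundamental_inverse[OF M]
  obtain \<delta> where \<delta>: "\<delta> > 0" and st1: "\<And>x t. solves_linear_system (hill_matrix a) x \<Longrightarrow>
      norm_sum (x t0) < \<delta> \<Longrightarrow> t \<ge> t0 \<Longrightarrow> norm_sum (x t) < 1"
    using st[unfolded hill_stable_def lyapunov_stable_def, rule_format, OF zero_less_one] by blast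
  define W where "W t = M t ** study_adj (M t0)" for t
  have entry: "norm (W t $ i $ j) \<le> 2 / \<delta>" if "t \<ge> t0" for t i j
  proof -
    define e :: "quat^2" where "e = (\<delta> / 2) *\<^sub>R axis j 1"
    have "norm_sum e = \<delta> / 2"
      using \<delta> exhaust_2[of j] by (auto simp: norm_sum_def e_def axis_def sum_2)
    moreover have "solves_linear_system (hill_matrix a) (\<lambda>t. W t *v e)"
      using fundamental_matrix_solves[OF M, of "study_adj (M t0) *v e"]
      by (simp add: W_def matrix_vector_mul_assoc)
    ultimately have "norm_sum (W t *v e) < 1"
      using st1[of "\<lambda>t. W t *v e" t] that \<delta> by (simp add: W_def inv)
    then have "norm ((W t *v e) $ i) < 1"
      using norm_sum_bounds(1)[of "W t *v e"] Finite_Cartesian_Product.norm_nth_le[of "W t *v e" i]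
      by linarith
    moreover have "(W t *v e) $ i = (\<delta> / 2) *\<^sub>R W t $ i $ j"
      using exhaust_2[of j] by (auto simp: matrix_vector_mult_def e_def axis_def sum_2)
    ultimately show ?thesis
      using \<delta> by (simp add: field_simps)
  qed
  have W: "norm (W t) \<le> 8 / \<delta>" if "t \<ge> t0" for t
  proof -
    have "norm (W t) \<le> (\<Sum>i\<in>UNIV. norm (W t $ i))"
      by (rule norm_vec_le_sum)
    also have "\<dots> \<le> (\<Sum>i\<in>UNIV. \<Sum>j\<in>UNIV. norm (W t $ i $ j))"
      by (intro sum_mono norm_vec_le_sum)
    also have "\<dots> \<le> (\<Sum>i\<in>(UNIV :: 2 set). \<Sum>j\<in>(UNIV :: 2 set). 2 / \<delta>)"
      by (intro sum_mono entry that)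
    finally show ?thesis by simp
  qed
  obtain K where K: "K \<ge> 0" "\<And>A B. norm ((A :: quat^2^2) ** (B :: quat^2^2)) \<le> norm A * norm B * K"
    using bounded_bilinear.nonneg_bounded[OF bounded_bilinear_matrix_matrix_mult] by blast
  show ?thesis
  proof (intro exI allI impI)
    fix t assume t: "t \<ge> t0"
    have "M t = W t ** M t0"
      by (simp add: W_def inv flip: matrix_mul_assoc)
    then have "norm (M t) \<le> norm (W t) * norm (M t0) * K"
      using K(2) by metis
    also have "\<dots> \<le> 8 / \<delta> * norm (M t0) * K"
      using W[OF t] K(1) by (intro mult_right_mono) auto
    finally show "norm (M t) \<le> 8 / \<delta> * norm (M t0) * K" .
  qed
qed

lemma hill_stable_if_bounded:
  assumes M: "principal_fundamental_matrix (hill_matrix a) s M"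
    and B: "\<And>t. t \<ge> t0 \<Longrightarrow> norm (M t) \<le> B"
  shows "hill_stable a t0"
proof -
  obtain K where K: "K \<ge> 0" "\<And>A x. norm ((A :: quat^2^2) *v (x :: quat^2)) \<le> norm A * norm x * K"
    using bounded_bilinear.nonneg_bounded[OF bounded_bilinear_matrix_vector_mult] by blast
  have B0: "B \<ge> 0"
    using B[of t0] norm_ge_zero[of "M t0"] by linarith
  define C where "C = 2 * (B * (norm (study_adj (M t0)) * K) * K) + 1"
  have C: "C > 0"
    using B0 K by (simp add: C_def add_nonneg_pos)
  have est: "norm_sum (x t) \<le> C * norm_sum (x t0)"
    if x: "solves_linear_system (hill_matrix a) x" and t: "t \<ge> t0" for x t
  proof -
    let ?y = "study_adj (M t0) *v x t0"
    have "norm (x t) \<le> norm (M t) * norm ?y * K"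
      using K(2)[of "M t" ?y] hill_solution_unique[OF M x, of t t0] by simp
    also have "\<dots> \<le> B * (norm (study_adj (M t0)) * norm (x t0) * K) * K"
      using B0 K by (intro mult_right_mono mult_mono B t) auto
    also have "\<dots> = (B * (norm (study_adj (M t0)) * K) * K) * norm (x t0)"
      by (simp add: mult_ac)
    finally have "norm_sum (x t) \<le> 2 * (B * (norm (study_adj (M t0)) * K) * K) * norm (x t0)"
      using norm_sum_bounds(2)[of "x t"] by linarith
    also have "\<dots> \<le> C * norm (x t0)"
      by (rule mult_right_mono) (simp_all add: C_def)
    also have "\<dots> \<le> C * norm_sum (x t0)"
      using C by (intro mult_left_mono norm_sum_bounds) auto
    finally show ?thesis .
  qed
  show ?thesis
    unfolding hill_stable_def lyapunov_stable_def
  proof (intro allI impI)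
    fix \<epsilon> :: real assume "\<epsilon> > 0"
    then show "\<exists>\<delta>>0. \<forall>x. solves_linear_system (hill_matrix a) x \<and> norm_sum (x t0) < \<delta> \<longrightarrow>
        (\<forall>t\<ge>t0. norm_sum (x t) < \<epsilon>)"
      using C est by (intro exI[of _ "\<epsilon> / C"])
        (auto simp: pos_less_divide_eq mult.commute intro: le_less_trans)
  qed
qed

section \<open>Stability and the monodromy matrix\<close>

text \<open>Both \<open>M T = mat 1\<close> and \<open>M T = - mat 1\<close> square to the identity, which makes \<open>M\<close> periodic with
  period \<open>2 T\<close>, hence bounded.\<close>

lemma hill_stable_if_monodromy_involution:
  assumes T: "T > 0" and per: "\<And>t. a (t + T) = a t"
    and M: "principal_fundamental_matrix (hill_matrix a) 0 M"
    and inv: "M T ** M T = mat 1"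
  shows "hill_stable a t0"
proof -
  have "continuous_on {t0..t0 + 2 * T} M"
    using M by (auto simp: principal_fundamental_matrix_def
      intro!: continuous_at_imp_continuous_on has_vector_derivative_continuous)
  then have "bounded (M ` {t0..t0 + 2 * T})"
    by (intro compact_imp_bounded compact_continuous_image) auto
  then obtain B where B: "\<forall>x\<in>M ` {t0..t0 + 2 * T}. norm x \<le> B"
    unfolding bounded_iff ..
  have P2: "M (t + 2 * T) = M t" for t
    using hill_monodromy[OF M per, of "t + T"] hill_monodromy[OF M per, of t] inv
    by (simp add: add.assoc flip: matrix_mul_assoc)
  have Pn: "M (t + of_nat n * (2 * T)) = M t" for t n
  proof (induction n)
    case (Suc n)
    then show ?case
      using P2[of "t + of_nat n * (2 * T)"] by (simp add: algebra_simps)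
  qed simp
  show ?thesis
  proof (rule hill_stable_if_bounded[OF M])
    fix t assume "t \<ge> t0"
    define n where "n = nat \<lfloor>(t - t0) / (2 * T)\<rfloor>"
    define r where "r = t - of_nat n * (2 * T)"
    have "real n \<le> (t - t0) / (2 * T)" "(t - t0) / (2 * T) < real n + 1"
      using \<open>t \<ge> t0\<close> T unfolding n_def by (simp_all add: of_nat_nat)
    then have "r \<in> {t0..t0 + 2 * T}"
      using T by (simp add: r_def field_simps)
    moreover have "M t = M r"
      using Pn[of r n] by (simp add: r_def)
    ultimately show "norm (M t) \<le> B"
      using B by simp
  qed
qed

text \<open>The sampled matrices \<open>M (t0 + n T)\<close> grow by right multiplication with \<open>M T\<close>. Stability bounds them and
  the constant Study determinant bounds their inverses, so \<open>M T\<close> is an isometry of some positive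
  definite form, and so is \<open>- M T\<close>, which gives the lower bound on the trace.\<close>

lemma hill_stable_imp_trace:
  assumes T: "T > 0" and per: "\<And>t. a (t + T) = a t"
    and M: "principal_fundamental_matrix (hill_matrix a) 0 M"
    and st: "hill_stable a t0"
  shows "\<bar>qre (trace (M T))\<bar> \<le> 2"
    and "qre (trace (M T)) = 2 \<Longrightarrow> M T = mat 1"
    and "qre (trace (M T)) = - 2 \<Longrightarrow> M T = - mat 1"
proof -
  note inv = hill_fundamental_inverse[OF M]
  define X where "X n = M (t0 + of_nat n * T)" for n
  obtain B where B: "\<forall>t\<ge>t0. norm (M t) \<le> B"
    using hill_stable_imp_bounded[OF M st] ..
  have X_Suc: "X (Suc n) = X n ** M T" for n
    using hill_monodromy[OF M per, of "t0 + of_nat n * T"] by (simp add: X_def algebra_simps)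
  have bdd: "bounded (range X)"
    using B T by (auto simp: X_def bounded_iff intro!: exI[of _ B])
  have "study_adj (X n) ** X n = mat 1" for n
    by (simp add: X_def inv)
  then obtain H where H: "posdef_hermitian H" and iso: "ctranspose (M T) ** H ** M T = H"
    by (rule bounded_cocycle_invariant_form[OF X_Suc _ bdd bounded_study_adj_range[OF bdd]])
  have "ctranspose (- M T) ** H ** (- M T) = H"
    by (simp add: iso bounded_bilinear.minus_left[OF bounded_bilinear_matrix_matrix_mult]
      bounded_bilinear.minus_right[OF bounded_bilinear_matrix_matrix_mult]
      linear_neg[OF bounded_linear.linear[OF bounded_linear_ctranspose]])
  note pos = isometry_trace[OF H iso] and neg = isometry_trace[OF H this]
  have tr: "qre (trace (- M T)) = - qre (trace (M T))"
    by (simp add: trace_def sum_2)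
  show "\<bar>qre (trace (M T))\<bar> \<le> 2"
    using pos(1) neg(1) tr by simp
  show "M T = mat 1" if "qre (trace (M T)) = 2"
    using pos(2) that by simp
  show "M T = - mat 1" if "qre (trace (M T)) = - 2"
    using neg(2) that tr by (simp add: minus_equation_iff[of "M T"])
qed

theorem mainTheorem5:
  fixes T t0 :: real and a :: "real \<Rightarrow> quat" and M :: "real \<Rightarrow> quat^2^2"
  assumes "T > 0"
    and "continuous_on UNIV a"
    and "\<And>t. a (t + T) = a t"
    and "principal_fundamental_matrix (hill_matrix a) 0 M"
  shows "(\<bar>qre (trace (M T))\<bar> > 2 \<longrightarrow> hill_unstable a t0) \<and>
         (qre (trace (M T)) = 2 \<longrightarrow> (hill_stable a t0 \<longleftrightarrow> M T = mat 1)) \<and>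
         (qre (trace (M T)) = - 2 \<longrightarrow> (hill_stable a t0 \<longleftrightarrow> M T = - mat 1))"
proof -
  note nec = hill_stable_imp_trace[OF assms(1,3,4)]
  have suf: "hill_stable a t0" if "M T = mat 1 \<or> M T = - mat 1"
  proof (rule hill_stable_if_monodromy_involution[OF assms(1,3,4)])
    show "M T ** M T = mat 1"
      using that by (auto simp: bounded_bilinear.minus_left[OF bounded_bilinear_matrix_matrix_mult]
        bounded_bilinear.minus_right[OF bounded_bilinear_matrix_matrix_mult])
  qed
  show ?thesis
  proof (intro conjI impI iffI)
    show "hill_unstable a t0" if "\<bar>qre (trace (M T))\<bar> > 2"
      using nec(1) that by (meson not_le)
  qed (use nec(2,3) suf in blast)+
qed

end
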